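(* Let $K,L\subset\mathbb R^n$ be convex bodies satisfying $M(K,L)=|K\cap(-L)|$. Then, for every $0\le\theta_0\le\theta<1$, $$\frac{K+_{\theta_0}L}{1-\theta_0^{\frac1n}}\ \subseteq\ \frac{K+_\theta L}{1-\theta^{\frac1n}}.$$
   Context: A convex body in $\mathbb R^n$ is a compact convex set with non-empty interior; $|\cdot|$ denotes Lebesgue measure. $K+L$ is the Minkowski sum, $M(K,L)=\sup_{x\in K+L}|K\cap(x-L)|$, and for $\theta\in[0,1]$, $K+_\theta L=\{x\in K+L:\ |K\cap(x-L)|\ge\theta M(K,L)\}$. For a set $A$ and $c>0$, $A/c=\{a/c: a\in A\}$. *)

theory Defs
  imports "HOL-Analysis.Analysis" "HOL-Library.Set_Algebras"
begin

definition convex_body :: "(real ^ 'n) set \<Rightarrow> bool" where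
  "convex_body K \<longleftrightarrow> compact K \<and> convex K \<and> interior K \<noteq> {}"

definition conv_vol :: "(real ^ 'n) set \<Rightarrow> (real ^ 'n) set \<Rightarrow> real ^ 'n \<Rightarrow> real" where
  "conv_vol K L x = measure lebesgue (K \<inter> (\<lambda>y. x - y) ` L)"

text \<open>For convex bodies the supremum is over a nonempty set of reals bounded above by the
  volume of \<open>K\<close>, so the supremum in the reals is the genuine one.\<close>

definition max_conv :: "(real ^ 'n) set \<Rightarrow> (real ^ 'n) set \<Rightarrow> real" where
  "max_conv K L = (SUP x\<in>K + L. conv_vol K L x)"

definition theta_sum :: "real \<Rightarrow> (real ^ 'n) set \<Rightarrow> (real ^ 'n) set \<Rightarrow> (real ^ 'n) set" where
  "theta_sum \<theta> K L = {x \<in> K + L. conv_vol K L x \<ge> \<theta> * max_conv K L}"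

definition set_divide :: "(real ^ 'n) set \<Rightarrow> real \<Rightarrow> (real ^ 'n) set" where
  "set_divide A c = (\<lambda>a. a /\<^sub>R c) ` A"

end

theory Submission
  imports Defs
begin

text \<open>
  If \<open>0 \<le> \<lambda> \<le> 1\<close>, convexity gives
  \<open>\<lambda> (K \<inter> (x - L)) + (1 - \<lambda>) (K \<inter> (-L)) \<subseteq> K \<inter> (\<lambda> x - L)\<close>, so by the Brunn-Minkowski inequality
  the \<open>n\<close>-th root of \<open>|K \<inter> (x - L)|\<close> is concave in \<open>x \<in> K + L\<close>. Taking
  \<open>\<lambda> = (1 - \<theta>\<^sup>1\<^sup>/\<^sup>n) / (1 - \<theta>\<^sub>0\<^sup>1\<^sup>/\<^sup>n)\<close> and using that the maximum is attained at \<open>0\<close>, a point \<open>x\<close> of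
  \<open>K +\<^sub>\<theta>\<^sub>0 L\<close> is sent to the point \<open>\<lambda> x\<close> of \<open>K +\<^sub>\<theta> L\<close>.

  Brunn-Minkowski is obtained by the Hadwiger-Ohmann argument: it is the arithmetic-geometric mean
  inequality for boxes, follows for finite disjoint unions of boxes by induction on the number of
  boxes, and passes to open sets by inner approximation and to convex sets because their
  frontier is negligible.
\<close>

section \<open>Arithmetic-geometric mean inequality for side lengths\<close>

text \<open>At 0 both sides vanish, by the convention \<open>0 powr a = 0\<close>; this later covers
  the case \<open>\<theta>\<^sub>0 = 0\<close>.\<close>

lemma root_eq_powr_inverse:
  fixes x :: real
  assumes "0 < n" "0 \<le> x"
  shows "root n x = x powr (1 / real n)"
  using assms by (cases "x = 0") (auto simp: root_powr_inverse)

text \<open>After division by the root of the right-hand product, each term on the left is a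
  geometric mean of ratios \<open>u i / (u i + v i)\<close> or \<open>v i / (u i + v i)\<close>. It
  is at most the arithmetic mean, and the two arithmetic means add up to 1.\<close>

lemma root_prod_add_le:
  fixes u v :: "'i \<Rightarrow> real"
  assumes fin: "finite I" and ne: "I \<noteq> {}"
    and u: "\<And>i. i \<in> I \<Longrightarrow> 0 < u i" and v: "\<And>i. i \<in> I \<Longrightarrow> 0 < v i"
  shows "root (card I) (\<Prod>i\<in>I. u i) + root (card I) (\<Prod>i\<in>I. v i)
    \<le> root (card I) (\<Prod>i\<in>I. u i + v i)"
proof -
  let ?n = "card I"
  have n: "0 < ?n" using fin ne by (simp add: card_gt_0_iff)
  have pos: "0 < u i + v i" if "i \<in> I" for i using u[OF that] v[OF that] by simp
  define P where "P = (\<Prod>i\<in>I. u i + v i)"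
  have P: "0 < P" unfolding P_def by (intro prod_pos) (use pos in auto)
  have am: "root ?n (\<Prod>i\<in>I. w i) / root ?n P \<le> (\<Sum>i\<in>I. w i / (u i + v i)) / real ?n"
    if w: "\<And>i. i \<in> I \<Longrightarrow> 0 < w i" for w
  proof -
    have "0 \<le> w i / (u i + v i)" if "i \<in> I" for i
      using w[OF that] pos[OF that] by simp
    then have "(\<Prod>i\<in>I. w i / (u i + v i)) powr (1 / ?n) \<le> (\<Sum>i\<in>I. w i / (u i + v i) / ?n)"
      and nn: "0 \<le> (\<Prod>i\<in>I. w i / (u i + v i))"
      using arith_geom_mean[OF fin ne, of "\<lambda>i. w i / (u i + v i)"] by (auto intro: prod_nonneg)
    then have "root ?n (\<Prod>i\<in>I. w i / (u i + v i)) \<le> (\<Sum>i\<in>I. w i / (u i + v i) / ?n)"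
      by (simp only: root_eq_powr_inverse[OF n nn])
    then show ?thesis
      by (simp add: prod_dividef P_def real_root_divide sum_divide_distrib)
  qed
  have "(root ?n (\<Prod>i\<in>I. u i) + root ?n (\<Prod>i\<in>I. v i)) / root ?n P
      \<le> (\<Sum>i\<in>I. u i / (u i + v i) + v i / (u i + v i)) / real ?n"
    using am[of u] am[of v] u v by (simp add: add_divide_distrib sum.distrib)
  also have "(\<Sum>i\<in>I. u i / (u i + v i) + v i / (u i + v i)) = (\<Sum>i\<in>I. 1)"
    by (intro sum.cong refl) (metis add_divide_distrib divide_self less_irrefl pos)
  finally show ?thesis
    using n P by (simp add: P_def[symmetric] pos_divide_le_eq)
qed

section \<open>Minkowski sums of open sets and of boxes\<close>

lemma open_set_plus:
  fixes A B :: "'a::real_normed_vector set"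
  assumes "open A"
  shows "open (A + B)"
proof -
  have "A + B = (\<Union>x\<in>A. \<Union>y\<in>B. {x + y})" by (auto simp: set_plus_def)
  then show ?thesis using open_sums[of A B] assms by auto
qed

lemma bounded_set_plus:
  fixes A B :: "'a::real_normed_vector set"
  assumes "bounded A" "bounded B"
  shows "bounded (A + B)"
proof -
  have "A + B = (\<Union>x\<in>A. \<Union>y\<in>B. {x + y})" by (auto simp: set_plus_def)
  then show ?thesis using bounded_sums[OF assms] by auto
qed

text \<open>Each coordinate of \<open>x\<close> sits at some relative position \<open>t i\<close> in
  the summed interval; cutting both given intervals at that same position splits \<open>x\<close>
  into a point of each box.\<close>

lemma box_plus_box_supset:
  fixes a b c d :: "'a::euclidean_space"
  assumes "box a b \<noteq> {}" "box c d \<noteq> {}"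
  shows "box (a + c) (b + d) \<subseteq> box a b + box c d"
proof
  fix x assume x: "x \<in> box (a + c) (b + d)"
  have ab: "\<And>i. i \<in> Basis \<Longrightarrow> a \<bullet> i < b \<bullet> i" and cd: "\<And>i. i \<in> Basis \<Longrightarrow> c \<bullet> i < d \<bullet> i"
    using assms by (auto simp: box_ne_empty)
  define t where "t i = (x \<bullet> i - a \<bullet> i - c \<bullet> i) / ((b \<bullet> i - a \<bullet> i) + (d \<bullet> i - c \<bullet> i))" for i
  define y where "y = (\<Sum>i\<in>Basis. (a \<bullet> i + t i * (b \<bullet> i - a \<bullet> i)) *\<^sub>R i)"
  have y: "y \<bullet> i = a \<bullet> i + t i * (b \<bullet> i - a \<bullet> i)" if "i \<in> Basis" for i
    using that by (simp add: y_def)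
  have t: "0 < t i" "t i < 1" "x \<bullet> i - y \<bullet> i = c \<bullet> i + t i * (d \<bullet> i - c \<bullet> i)" if i: "i \<in> Basis" for i
  proof -
    have s: "0 < (b \<bullet> i - a \<bullet> i) + (d \<bullet> i - c \<bullet> i)" using ab[OF i] cd[OF i] by simp
    have xi: "a \<bullet> i + c \<bullet> i < x \<bullet> i" "x \<bullet> i < b \<bullet> i + d \<bullet> i"
      using x i by (auto simp: mem_box inner_add_left)
    show "0 < t i" "t i < 1" using s xi by (simp_all add: t_def)
    have "t i * ((b \<bullet> i - a \<bullet> i) + (d \<bullet> i - c \<bullet> i)) = x \<bullet> i - a \<bullet> i - c \<bullet> i"
      using s by (simp add: t_def)
    then show "x \<bullet> i - y \<bullet> i = c \<bullet> i + t i * (d \<bullet> i - c \<bullet> i)"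
      by (simp add: y[OF i] algebra_simps)
  qed
  have seg: "l < l + s * (u - l)" "l + s * (u - l) < u" if "l < u" "0 < s" "s < 1" for l u s :: real
  proof -
    have "s * (u - l) < 1 * (u - l)" using that by (intro mult_strict_right_mono) auto
    then show "l + s * (u - l) < u" by simp
    show "l < l + s * (u - l)" using that by simp
  qed
  have "y \<in> box a b" using seg ab t by (auto simp: mem_box y)
  moreover have "x - y \<in> box c d" using seg cd t by (auto simp: mem_box inner_diff_left)
  ultimately show "x \<in> box a b + box c d"
    using set_plus_intro[of y "box a b" "x - y" "box c d"] by simp
qed

text \<open>Volumes of boxes are products of side lengths, and side lengths add under Minkowski sum,
  so this is \<open>root_prod_add_le\<close>.\<close>

lemma brunn_minkowski_box:
  fixes a b c d :: "'a::euclidean_space"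
  assumes ne: "box a b \<noteq> {}" "box c d \<noteq> {}"
  shows "root DIM('a) (measure lebesgue (box a b)) + root DIM('a) (measure lebesgue (box c d))
    \<le> root DIM('a) (measure lebesgue (box a b + box c d))"
proof -
  have ab: "\<And>i. i \<in> Basis \<Longrightarrow> a \<bullet> i < b \<bullet> i" and cd: "\<And>i. i \<in> Basis \<Longrightarrow> c \<bullet> i < d \<bullet> i"
    using ne by (auto simp: box_ne_empty)
  have m: "measure lebesgue (box l u) = (\<Prod>i\<in>Basis. u \<bullet> i - l \<bullet> i)"
    if "\<And>i. i \<in> Basis \<Longrightarrow> l \<bullet> i < u \<bullet> i" for l u :: 'a
    using that by (simp add: measure_lborel_box_eq inner_diff_left less_imp_le)
  have s: "(a + c) \<bullet> i < (b + d) \<bullet> i" if "i \<in> Basis" for i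
    using ab[OF that] cd[OF that] by (simp add: inner_add_left)
  have "root DIM('a) (measure lebesgue (box a b)) + root DIM('a) (measure lebesgue (box c d))
      \<le> root DIM('a) (\<Prod>i\<in>Basis. (b \<bullet> i - a \<bullet> i) + (d \<bullet> i - c \<bullet> i))"
    using root_prod_add_le[of "Basis :: 'a set" "\<lambda>i. b \<bullet> i - a \<bullet> i" "\<lambda>i. d \<bullet> i - c \<bullet> i"] ab cd
    by (simp only: m) simp
  also have "(\<Prod>i\<in>Basis. (b \<bullet> i - a \<bullet> i) + (d \<bullet> i - c \<bullet> i)) = measure lebesgue (box (a + c) (b + d))"
    by (subst m[OF s]) (auto intro!: prod.cong simp: inner_add_left)
  also have "root DIM('a) \<dots> \<le> root DIM('a) (measure lebesgue (box a b + box c d))"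
    by (intro real_root_le_mono measure_mono_fmeasurable box_plus_box_supset ne lmeasurable_open
        bounded_set_plus open_set_plus) auto
  finally show ?thesis .
qed

section \<open>Finite families of disjoint open boxes and their cuts\<close>

text \<open>Open boxes keep unions and their Minkowski sums open, hence measurable. Excluding empty
  members gives every nonempty family a union of positive measure.\<close>

definition box_family :: "'a::euclidean_space set set \<Rightarrow> bool" where
  "box_family P \<longleftrightarrow> finite P \<and> (\<forall>X\<in>P. X \<noteq> {} \<and> (\<exists>a b. X = box a b)) \<and> disjoint P"

lemma open_Union_box_family: "box_family P \<Longrightarrow> open (\<Union>P)"
  by (force simp: box_family_def)

lemma bounded_Union_box_family: "box_family P \<Longrightarrow> bounded (\<Union>P)"
  unfolding box_family_def by (metis bounded_Union bounded_box)

lemma measure_open_pos: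
  fixes S :: "'a::euclidean_space set"
  assumes "open S" "bounded S" "S \<noteq> {}"
  shows "0 < measure lebesgue S"
  using open_not_negligible[OF assms(1,3)] lmeasurable_open[OF assms(2,1)]
  by (auto simp: negligible_iff_measure zero_less_measure_iff)

text \<open>Empty traces are discarded, both to stay within \<open>box_family\<close> and to let the
  cardinality drop once \<open>H\<close> misses a member.\<close>

definition cut_family :: "'a set set \<Rightarrow> 'a set \<Rightarrow> 'a set set" where
  "cut_family P H = (\<lambda>X. X \<inter> H) ` P - {{}}"

lemma Union_cut_family: "\<Union>(cut_family P H) = \<Union>P \<inter> H"
  by (auto simp: cut_family_def)

lemma card_cut_family_le: "finite P \<Longrightarrow> card (cut_family P H) \<le> card P"
  unfolding cut_family_def by (meson Diff_subset card_image_le card_mono finite_imageI order_trans)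

lemma card_cut_family_less:
  assumes "finite P" "X \<in> P" "X \<inter> H = {}"
  shows "card (cut_family P H) < card P"
proof -
  have "cut_family P H \<subseteq> (\<lambda>X. X \<inter> H) ` (P - {X})"
    using assms by (auto simp: cut_family_def)
  then have "card (cut_family P H) \<le> card (P - {X})"
    using assms by (meson card_image_le card_mono finite_Diff finite_imageI order_trans)
  also have "\<dots> < card P" using assms by (meson card_Diff1_less)
  finally show ?thesis .
qed

lemma box_Int_lower_halfspace:
  fixes a b i :: "'a::euclidean_space"
  assumes "i \<in> Basis"
  shows "\<exists>a' b'. box a b \<inter> {x. x \<bullet> i < c} = box a' b'"
proof -
  \<comment> \<open>When \<open>c \<le> a \<bullet> i\<close>, the box with this corner is empty,
    and so is the intersection.\<close>
  define b' where "b' = (\<Sum>j\<in>Basis. (if j = i then min (b \<bullet> j) c else b \<bullet> j) *\<^sub>R j)"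
  have "b' \<bullet> j = (if j = i then min (b \<bullet> j) c else b \<bullet> j)" if "j \<in> Basis" for j
    using that by (simp add: b'_def)
  then have "box a b \<inter> {x. x \<bullet> i < c} = box a b'"
    using assms by (auto simp: mem_box split: if_splits)
  then show ?thesis by blast
qed

lemma box_Int_upper_halfspace:
  fixes a b i :: "'a::euclidean_space"
  assumes "i \<in> Basis"
  shows "\<exists>a' b'. box a b \<inter> {x. c < x \<bullet> i} = box a' b'"
proof -
  define a' where "a' = (\<Sum>j\<in>Basis. (if j = i then max (a \<bullet> j) c else a \<bullet> j) *\<^sub>R j)"
  have "a' \<bullet> j = (if j = i then max (a \<bullet> j) c else a \<bullet> j)" if "j \<in> Basis" for j
    using that by (simp add: a'_def)
  then have "box a b \<inter> {x. c < x \<bullet> i} = box a' b"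
    using assms by (auto simp: mem_box split: if_splits)
  then show ?thesis by blast
qed

text \<open>\<open>H\<close> enters only through its traces on boxes, so lower and upper halfspaces
  are treated at once.\<close>

lemma box_family_cut_family:
  assumes P: "box_family P" and H: "\<And>a b. \<exists>a' b'. box a b \<inter> H = box a' b'"
  shows "box_family (cut_family P H)"
  unfolding box_family_def
proof (intro conjI ballI)
  show "finite (cut_family P H)" using P by (simp add: box_family_def cut_family_def)
  show "disjoint (cut_family P H)"
    using P by (fastforce simp: box_family_def cut_family_def disjoint_def)
  fix X assume "X \<in> cut_family P H"
  then obtain Y where "Y \<in> P" "X = Y \<inter> H" "X \<noteq> {}" by (auto simp: cut_family_def)
  moreover from this obtain a b where "Y = box a b" using P unfolding box_family_def by blast
  ultimately show "X \<noteq> {}" "\<exists>a b. X = box a b" using H[of a b] by auto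
qed

section \<open>Volumes cut off by coordinate hyperplanes\<close>

text \<open>Strict inequalities keep both parts open; what is lost lies on a hyperplane and is
  negligible.\<close>

lemma measure_halfspace_split:
  fixes S :: "'a::euclidean_space set"
  assumes S: "open S" "bounded S" and i: "i \<in> Basis"
  shows "measure lebesgue (S \<inter> {x. x \<bullet> i < c}) + measure lebesgue (S \<inter> {x. c < x \<bullet> i})
    = measure lebesgue S"
proof -
  have o: "open {x::'a. x \<bullet> i < c}" "open {x::'a. c < x \<bullet> i}"
    by (auto intro!: open_Collect_less continuous_intros)
  have m: "S \<inter> {x. x \<bullet> i < c} \<in> lmeasurable" "S \<inter> {x. c < x \<bullet> i} \<in> lmeasurable"
    using S o by (auto intro!: lmeasurable_open simp: bounded_Int)
  have "measure lebesgue (S \<inter> {x. x \<bullet> i < c}) + measure lebesgue (S \<inter> {x. c < x \<bullet> i})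
      = measure lebesgue ((S \<inter> {x. x \<bullet> i < c}) \<union> (S \<inter> {x. c < x \<bullet> i}))"
  proof -
    have "(S \<inter> {x. x \<bullet> i < c}) \<inter> (S \<inter> {x. c < x \<bullet> i}) = {}" by auto
    then show ?thesis using measure_Un3[OF m] by simp
  qed
  also have "\<dots> = measure lebesgue S"
  proof (rule measure_negligible_symdiff)
    show "S \<in> lmeasurable" using S by (simp add: lmeasurable_open)
    have "negligible {x::'a. x \<bullet> i = c}"
      using negligible_hyperplane[of i c] i by (auto simp: inner_commute)
    then show "negligible (S - (S \<inter> {x. x \<bullet> i < c} \<union> S \<inter> {x. c < x \<bullet> i}) \<union>
        (S \<inter> {x. x \<bullet> i < c} \<union> S \<inter> {x. c < x \<bullet> i} - S))"
      by (rule negligible_subset) auto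
  qed
  finally show ?thesis .
qed

text \<open>Moving the threshold within \<open>d\<close> of \<open>c\<close> alters the cut only
  inside a slab around the hyperplane at \<open>c\<close>, whose measure within a bounding box is
  below \<open>e\<close>.\<close>

lemma continuous_measure_halfspace:
  fixes S :: "'a::euclidean_space set"
  assumes S: "open S" "bounded S" and i: "i \<in> Basis"
  shows "continuous_on UNIV (\<lambda>c. measure lebesgue (S \<inter> {x. x \<bullet> i < c}))"
  unfolding continuous_on_iff
proof (intro ballI allI impI)
  fix c e :: real assume "0 < e"
  obtain l u where lu: "S \<subseteq> cbox l u"
    using bounded_subset_cbox_symmetric[OF S(2)] by metis
  obtain d where d: "0 < d" "measure lebesgue (cbox l u \<inter> {x. \<bar>x \<bullet> i - c\<bar> \<le> d}) < e"
    using content_doublesplit[OF \<open>0 < e\<close> i, of l u c] by auto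
  have sl: "cbox l u \<inter> {x. \<bar>x \<bullet> i - c\<bar> \<le> d} \<in> lmeasurable"
    by (intro lmeasurable_compact compact_Int_closed compact_cbox closed_Collect_le continuous_intros)
  have hm: "S \<inter> {x. x \<bullet> i < s} \<in> lmeasurable" for s
    using S by (auto intro!: lmeasurable_open open_Int open_Collect_less continuous_intros simp: bounded_Int)
  have step: "\<bar>measure lebesgue (S \<inter> {x. x \<bullet> i < s}) - measure lebesgue (S \<inter> {x. x \<bullet> i < t})\<bar> < e"
    if "s \<le> t" "c - d \<le> s" "t \<le> c + d" for s t
  proof -
    have "measure lebesgue (S \<inter> {x. x \<bullet> i < s}) \<le> measure lebesgue (S \<inter> {x. x \<bullet> i < t})"
      using that hm by (intro measure_mono_fmeasurable) auto
    moreover have "measure lebesgue (S \<inter> {x. x \<bullet> i < t})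
        \<le> measure lebesgue (S \<inter> {x. x \<bullet> i < s} \<union> cbox l u \<inter> {x. \<bar>x \<bullet> i - c\<bar> \<le> d})"
      using that hm sl lu by (intro measure_mono_fmeasurable) auto
    moreover have "\<dots> \<le> measure lebesgue (S \<inter> {x. x \<bullet> i < s})
        + measure lebesgue (cbox l u \<inter> {x. \<bar>x \<bullet> i - c\<bar> \<le> d})"
      using hm sl by (intro measure_Un_le) auto
    ultimately show ?thesis using d by linarith
  qed
  show "\<exists>d>0. \<forall>c'\<in>UNIV. dist c' c < d \<longrightarrow>
      dist (measure lebesgue (S \<inter> {x. x \<bullet> i < c'})) (measure lebesgue (S \<inter> {x. x \<bullet> i < c})) < e"
  proof (intro exI[of _ d] conjI ballI impI d(1))
    fix c' assume "dist c' c < d"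
    then have "\<bar>c' - c\<bar> < d" by (simp add: dist_real_def)
    then show "dist (measure lebesgue (S \<inter> {x. x \<bullet> i < c'})) (measure lebesgue (S \<inter> {x. x \<bullet> i < c})) < e"
      unfolding dist_real_def using step[of c c'] step[of c' c] d(1) by linarith
  qed
qed

text \<open>Intermediate value theorem: thresholds beyond a bounding box cut off nothing on one side
  and all of \<open>S\<close> on the other.\<close>

lemma halfspace_cut_exists:
  fixes S :: "'a::euclidean_space set"
  assumes S: "open S" "bounded S" and i: "i \<in> Basis"
    and r: "0 \<le> r" "r \<le> measure lebesgue S"
  obtains c where "measure lebesgue (S \<inter> {x. x \<bullet> i < c}) = r"
proof -
  obtain u where "S \<subseteq> cbox (-u) u"
    using bounded_subset_cbox_symmetric[OF S(2)] by metis
  then have b: "- (u \<bullet> i) \<le> x \<bullet> i" "x \<bullet> i \<le> u \<bullet> i" if "x \<in> S" for x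
    using that i by (auto simp: mem_box)
  \<comment> \<open>The absolute value keeps the two thresholds in order; the offset 1 makes the
    strict inequality at the upper one hold on all of \<open>S\<close>.\<close>
  have "S \<inter> {x. x \<bullet> i < - \<bar>u \<bullet> i\<bar> - 1} = {}" "S \<inter> {x. x \<bullet> i < \<bar>u \<bullet> i\<bar> + 1} = S"
    using b by force+
  then have "\<exists>c\<ge>- \<bar>u \<bullet> i\<bar> - 1. c \<le> \<bar>u \<bullet> i\<bar> + 1 \<and> measure lebesgue (S \<inter> {x. x \<bullet> i < c}) = r"
    using r by (intro IVT' continuous_on_subset[OF continuous_measure_halfspace[OF S i]]) auto
  then show thesis using that by blast
qed


section \<open>Hadwiger-Ohmann induction on the number of boxes\<close>

text \<open>Two disjoint nonempty boxes are separated in some coordinate; \<open>c\<close> is the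
  upper end of the lower one, and openness keeps both off the hyperplane. Each open half misses one
  box and contains another, so both cut families are smaller and nonempty.\<close>

lemma box_family_separating_hyperplane:
  fixes P :: "'a::euclidean_space set set"
  assumes P: "box_family P" and card: "2 \<le> card P"
  obtains i c where "i \<in> Basis"
    "\<exists>X\<in>P. X \<inter> {x. x \<bullet> i < c} = {} \<and> X \<subseteq> {x. c < x \<bullet> i}"
    "\<exists>X\<in>P. X \<inter> {x. c < x \<bullet> i} = {} \<and> X \<subseteq> {x. x \<bullet> i < c}"
proof -
  obtain X Y where XY: "X \<in> P" "Y \<in> P" "X \<noteq> Y"
    using card card_le_Suc0_iff_eq[of P] P unfolding box_family_def by fastforce
  obtain a b c d where eq: "X = box a b" "Y = box c d" "X \<noteq> {}" "Y \<noteq> {}"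
    using P XY unfolding box_family_def by metis
  have "X \<inter> Y = {}" using P XY by (auto simp: box_family_def disjoint_def)
  then obtain i where i: "i \<in> Basis"
    "b \<bullet> i \<le> a \<bullet> i \<or> d \<bullet> i \<le> c \<bullet> i \<or> b \<bullet> i \<le> c \<bullet> i \<or> d \<bullet> i \<le> a \<bullet> i"
    unfolding eq disjoint_interval by blast
  have "a \<bullet> i < b \<bullet> i" "c \<bullet> i < d \<bullet> i"
    using eq i(1) by (auto simp: box_ne_empty)
  with i consider "b \<bullet> i \<le> c \<bullet> i" | "d \<bullet> i \<le> a \<bullet> i" by force
  then show thesis
  proof cases
    case 1
    then have "Y \<inter> {x. x \<bullet> i < b \<bullet> i} = {}" "Y \<subseteq> {x. b \<bullet> i < x \<bullet> i}"
      "X \<inter> {x. b \<bullet> i < x \<bullet> i} = {}" "X \<subseteq> {x. x \<bullet> i < b \<bullet> i}"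
      using i(1) unfolding eq by (force simp: mem_box)+
    with that[OF i(1), of "b \<bullet> i"] XY show thesis by blast
  next
    case 2
    then have "X \<inter> {x. x \<bullet> i < d \<bullet> i} = {}" "X \<subseteq> {x. d \<bullet> i < x \<bullet> i}"
      "Y \<inter> {x. d \<bullet> i < x \<bullet> i} = {}" "Y \<subseteq> {x. x \<bullet> i < d \<bullet> i}"
      using i(1) unfolding eq by (force simp: mem_box)+
    with that[OF i(1), of "d \<bullet> i"] XY show thesis by blast
  qed
qed

text \<open>Cutting both unions by parallel hyperplanes in the same volume ratio makes the
  inequality additive over the two halves.\<close>

lemma brunn_minkowski_box_family_step:
  fixes P Q :: "'a::euclidean_space set set"
  assumes P: "box_family P" and Q: "box_family Q" and card: "2 \<le> card P" and "Q \<noteq> {}"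
    and IH: "\<And>P' Q' :: 'a set set. \<lbrakk>box_family P'; box_family Q'; P' \<noteq> {}; Q' \<noteq> {}; card P' + card Q' < card P + card Q\<rbrakk>
      \<Longrightarrow> root DIM('a) (measure lebesgue (\<Union>P')) + root DIM('a) (measure lebesgue (\<Union>Q'))
        \<le> root DIM('a) (measure lebesgue (\<Union>P' + \<Union>Q'))"
  shows "root DIM('a) (measure lebesgue (\<Union>P)) + root DIM('a) (measure lebesgue (\<Union>Q))
    \<le> root DIM('a) (measure lebesgue (\<Union>P + \<Union>Q))"
proof -
  let ?\<mu> = "measure (lebesgue :: 'a measure)" and ?n = "DIM('a)"
  define A B where "A = \<Union>P" and "B = \<Union>Q"
  have A: "open A" "bounded A" and B: "open B" "bounded B"
    using P Q by (auto simp: A_def B_def open_Union_box_family bounded_Union_box_family)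
  have "B \<noteq> {}" using Q \<open>Q \<noteq> {}\<close> by (auto simp: B_def box_family_def)
  obtain i c where i: "i \<in> Basis"
    and c: "\<exists>X\<in>P. X \<inter> {x. x \<bullet> i < c} = {} \<and> X \<subseteq> {x. c < x \<bullet> i}"
      "\<exists>X\<in>P. X \<inter> {x. c < x \<bullet> i} = {} \<and> X \<subseteq> {x. x \<bullet> i < c}"
    using box_family_separating_hyperplane[OF P card] .
  let ?lo = "\<lambda>t. {x::'a. x \<bullet> i < t}" and ?hi = "\<lambda>t. {x::'a. t < x \<bullet> i}"
  have oH: "open (?lo t)" "open (?hi t)" for t
    by (auto intro!: open_Collect_less continuous_intros)
  have neA: "A \<inter> ?lo c \<noteq> {}" "A \<inter> ?hi c \<noteq> {}"
  proof -
    have "X \<noteq> {}" "X \<subseteq> A" if "X \<in> P" for X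
      using that P unfolding A_def box_family_def by blast+
    moreover obtain X Y where "X \<in> P" "X \<subseteq> ?hi c" "Y \<in> P" "Y \<subseteq> ?lo c" using c by metis
    ultimately show "A \<inter> ?lo c \<noteq> {}" "A \<inter> ?hi c \<noteq> {}"
      by (metis Int_greatest subset_empty)+
  qed
  have posA: "0 < ?\<mu> (A \<inter> ?lo c)" "0 < ?\<mu> (A \<inter> ?hi c)"
    by (intro measure_open_pos open_Int A(1) oH bounded_Int disjI1 A(2) neA)+
  have splitA: "?\<mu> (A \<inter> ?lo c) + ?\<mu> (A \<inter> ?hi c) = ?\<mu> A"
    by (rule measure_halfspace_split[OF A i])
  then have \<mu>A: "0 < ?\<mu> A" using posA by linarith
  have \<mu>B: "0 < ?\<mu> B" using B \<open>B \<noteq> {}\<close> by (intro measure_open_pos)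
  \<comment> \<open>\<open>q\<close> is the common volume ratio: \<open>d\<close> is chosen so that
    the lower part of \<open>B\<close> has \<open>q\<close> times the volume of the lower part of
    \<open>A\<close>, and the upper parts follow by subtraction.\<close>
  define q where "q = ?\<mu> B / ?\<mu> A"
  have q: "0 < q" "?\<mu> B = ?\<mu> A * q" using \<mu>A \<mu>B by (auto simp: q_def)
  obtain d where d: "?\<mu> (B \<inter> ?lo d) = ?\<mu> (A \<inter> ?lo c) * q"
  proof (rule halfspace_cut_exists[OF B i])
    show "0 \<le> ?\<mu> (A \<inter> ?lo c) * q" using q by simp
    show "?\<mu> (A \<inter> ?lo c) * q \<le> ?\<mu> B" 
      unfolding q(2) using splitA posA q(1) by (intro mult_right_mono) linarith+
  qed
  have d': "?\<mu> (B \<inter> ?hi d) = ?\<mu> (A \<inter> ?hi c) * q"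
    using measure_halfspace_split[OF B i, of d] d q(2) splitA by (simp add: algebra_simps flip: splitA)
  \<comment> \<open>The fixed ratio \<open>q\<close> turns the inequality for the cut families into
    a bound linear in the measure of \<open>A \<inter> H\<close>, so that the two halves can be
    added.\<close>
  have half: "?\<mu> (A \<inter> H) * (1 + root ?n q) ^ ?n \<le> ?\<mu> (A \<inter> H + B \<inter> H')"
    if H: "\<And>a b. \<exists>a' b'. box a b \<inter> H = box a' b'" and H': "\<And>a b. \<exists>a' b'. box a b \<inter> H' = box a' b'"
      and X: "\<exists>X\<in>P. X \<inter> H = {}" and pos: "0 < ?\<mu> (A \<inter> H)"
      and ratio: "?\<mu> (B \<inter> H') = ?\<mu> (A \<inter> H) * q" for H H'
  proof -
    define P' Q' where "P' = cut_family P H" and "Q' = cut_family Q H'"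
    have fam: "box_family P'" "box_family Q'"
      unfolding P'_def Q'_def using P Q H H' by (auto intro: box_family_cut_family)
    have U: "\<Union>P' = A \<inter> H" "\<Union>Q' = B \<inter> H'"
      by (simp_all add: P'_def Q'_def A_def B_def Union_cut_family)
    have "0 < ?\<mu> (\<Union>P')" "0 < ?\<mu> (\<Union>Q')" using pos ratio q by (simp_all add: U)
    then have ne: "P' \<noteq> {}" "Q' \<noteq> {}" by (metis Union_empty measure_empty less_irrefl)+
    \<comment> \<open>\<open>H\<close> misses a box of \<open>P\<close> and cutting adds none to
      \<open>Q\<close>, so the total count drops strictly.\<close>
    have "card P' < card P" "card Q' \<le> card Q"
      using X P Q card_cut_family_less[of P] card_cut_family_le[of Q]
      by (auto simp: P'_def Q'_def box_family_def)
    then have "root ?n (?\<mu> (A \<inter> H)) + root ?n (?\<mu> (B \<inter> H')) \<le> root ?n (?\<mu> (A \<inter> H + B \<inter> H'))"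
      using IH[OF fam ne] by (simp add: U)
    then have "root ?n (?\<mu> (A \<inter> H)) * (1 + root ?n q) \<le> root ?n (?\<mu> (A \<inter> H + B \<inter> H'))"
      by (simp add: ratio real_root_mult algebra_simps)
    then have "(root ?n (?\<mu> (A \<inter> H)) * (1 + root ?n q)) ^ ?n \<le> root ?n (?\<mu> (A \<inter> H + B \<inter> H')) ^ ?n"
      using q by (intro power_mono) auto
    then show ?thesis by (simp add: power_mult_distrib real_root_pow_pos2)
  qed
  let ?S = "A \<inter> ?lo c + B \<inter> ?lo d" and ?T = "A \<inter> ?hi c + B \<inter> ?hi d"
  have mS: "?S \<in> lmeasurable" "?T \<in> lmeasurable"
    using A B oH by (auto intro!: lmeasurable_open open_set_plus bounded_set_plus simp: bounded_Int)
  \<comment> \<open>The hyperplane at height \<open>c + d\<close> separates the sum of the lower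
    parts from the sum of the upper parts.\<close>
  have disj: "?S \<inter> ?T = {}"
  proof -
    have "z \<bullet> i < c + d" if "z \<in> ?S" for z
      using that by (auto elim!: set_plus_elim simp: inner_add_left)
    moreover have "c + d < z \<bullet> i" if "z \<in> ?T" for z
      using that by (auto elim!: set_plus_elim simp: inner_add_left)
    ultimately show ?thesis by fastforce
  qed
  have lo: "\<exists>a' b'. box a b \<inter> ?lo t = box a' b'" and hi: "\<exists>a' b'. box a b \<inter> ?hi t = box a' b'" for a b t
    using box_Int_lower_halfspace[OF i] box_Int_upper_halfspace[OF i] by blast+
  have "?\<mu> A * (1 + root ?n q) ^ ?n
      = ?\<mu> (A \<inter> ?lo c) * (1 + root ?n q) ^ ?n + ?\<mu> (A \<inter> ?hi c) * (1 + root ?n q) ^ ?n"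
    by (simp add: distrib_right flip: splitA)
  also have "\<dots> \<le> ?\<mu> ?S + ?\<mu> ?T"
    using c by (intro add_mono half lo hi posA d d') blast+
  also have "\<dots> = ?\<mu> (?S \<union> ?T)"
    using measure_Un3[OF mS] by (simp add: disj)
  also have "\<dots> \<le> ?\<mu> (A + B)"
  proof (rule measure_mono_fmeasurable)
    show "?S \<union> ?T \<subseteq> A + B" by (auto simp: set_plus_def)
    show "A + B \<in> lmeasurable" using A B by (intro lmeasurable_open open_set_plus bounded_set_plus)
  qed (use mS in auto)
  finally have "root ?n (?\<mu> A * (1 + root ?n q) ^ ?n) \<le> root ?n (?\<mu> (A + B))"
    by (simp add: real_root_le_iff)
  then have "root ?n (?\<mu> A) * (1 + root ?n q) \<le> root ?n (?\<mu> (A + B))"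
    using q by (simp add: real_root_mult real_root_power_cancel)
  moreover have "root ?n (?\<mu> B) = root ?n (?\<mu> A) * root ?n q" by (simp add: q(2) real_root_mult)
  ultimately show ?thesis by (simp add: A_def B_def algebra_simps)
qed

text \<open>Strong induction on the total number of boxes. A family with at least two boxes is cut,
  the roles of \<open>P\<close> and \<open>Q\<close> being exchanged by commutativity if it is
  \<open>Q\<close>; two single boxes form the base case.\<close>

lemma brunn_minkowski_box_family:
  fixes P Q :: "'a::euclidean_space set set"
  assumes "box_family P" "box_family Q" "P \<noteq> {}" "Q \<noteq> {}"
  shows "root DIM('a) (measure lebesgue (\<Union>P)) + root DIM('a) (measure lebesgue (\<Union>Q))
    \<le> root DIM('a) (measure lebesgue (\<Union>P + \<Union>Q))"
  using assms
proof (induction "card P + card Q" arbitrary: P Q rule: less_induct)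
  case less
  have fin: "finite P" "finite Q" using less.prems by (auto simp: box_family_def)
  then have "0 < card P" "0 < card Q" using less.prems by (auto simp: card_gt_0_iff)
  then consider "2 \<le> card P" | "2 \<le> card Q" | "card P = 1" "card Q = 1" by linarith
  then show ?case
  proof cases
    case 1
    show ?thesis
      by (rule brunn_minkowski_box_family_step[OF less.prems(1,2) 1 less.prems(4)]) (rule less.hyps)
  next
    case 2
    have "root DIM('a) (measure lebesgue (\<Union>Q)) + root DIM('a) (measure lebesgue (\<Union>P))
      \<le> root DIM('a) (measure lebesgue (\<Union>Q + \<Union>P))"
      by (rule brunn_minkowski_box_family_step[OF less.prems(2,1) 2 less.prems(3)])
        (rule less.hyps; simp)
    then show ?thesis by (simp add: add.commute)
  next
    case 3
    then obtain X Y where "P = {X}" "Q = {Y}" by (metis card_1_singletonE)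
    moreover from this obtain a b c d where "X = box a b" "Y = box c d" "X \<noteq> {}" "Y \<noteq> {}"
      using less.prems unfolding box_family_def by auto
    ultimately show ?thesis using brunn_minkowski_box[of a b c d] by simp
  qed
qed

section \<open>Brunn-Minkowski for open and for convex sets\<close>

text \<open>An open set is a countable union of closed boxes, and finitely many of them capture its
  volume up to \<open>e\<close>. Their union is divided into non-overlapping boxes; passing to
  interiors loses only finitely many negligible frontiers.\<close>

lemma open_box_family_approximation:
  fixes S :: "'a::euclidean_space set"
  assumes S: "open S" "bounded S" and "0 < e"
  obtains P where "box_family P" "\<Union>P \<subseteq> S" "measure lebesgue S - e < measure lebesgue (\<Union>P)"
proof -
  obtain \<D> where \<D>: "countable \<D>" "\<D> \<subseteq> Pow S" "\<And>X. X \<in> \<D> \<Longrightarrow> \<exists>a b. X = cbox a b" "\<Union>\<D> = S"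
    using open_countable_Union_open_cbox[OF S(1)] by metis
  have meas: "X \<in> lmeasurable" if "X \<in> \<D>" for X using \<D>(3)[OF that] by auto
  have bd: "measure lebesgue (\<Union>D') \<le> measure lebesgue S" if "D' \<subseteq> \<D>" "finite D'" for D'
  proof (rule measure_mono_fmeasurable)
    show "\<Union>D' \<subseteq> S" using that \<D>(4) by blast
    have "\<Union>D' \<in> lmeasurable" using that meas by (intro fmeasurable.finite_Union) auto
    then show "\<Union>D' \<in> sets lebesgue" by auto
  qed (use S in \<open>simp add: lmeasurable_open\<close>)
  obtain D' where D': "D' \<subseteq> \<D>" "finite D'" "measure lebesgue S - e < measure lebesgue (\<Union>D')"
    using measure_countable_Union_approachable[OF \<D>(1) \<open>0 < e\<close> meas bd] \<D>(4) by metis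
  obtain p where p: "p division_of \<Union>D'"
    using elementary_unions_intervals[of D'] D' \<D>(3) by (metis subsetD)
  define P where "P = interior ` p - {{}}"
  have "box_family P"
    unfolding box_family_def
  proof (intro conjI ballI)
    show "finite P" using p by (auto simp: P_def)
    show "disjoint P" using division_ofD(5)[OF p] unfolding P_def disjoint_def by blast
    fix X assume "X \<in> P"
    then obtain Y where "Y \<in> p" "X = interior Y" "X \<noteq> {}" by (auto simp: P_def)
    then show "X \<noteq> {}" "\<exists>a b. X = box a b" using division_ofD(4)[OF p] by (metis interior_cbox)+
  qed
  moreover have sub: "\<Union>P \<subseteq> \<Union>D'"
    using division_ofD(6)[OF p] interior_subset unfolding P_def by blast
  moreover have "measure lebesgue (\<Union>P) = measure lebesgue (\<Union>D')"
  proof (rule measure_negligible_symdiff)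
    show "\<Union>D' \<in> lmeasurable" using D' meas by (intro fmeasurable.finite_Union) auto
    have "negligible (\<Union>(frontier ` p))"
    proof (rule negligible_Union)
      show "finite (frontier ` p)" using p by auto
      show "negligible T" if "T \<in> frontier ` p" for T
        using that division_ofD(4)[OF p] negligible_convex_frontier convex_box(1) by (metis imageE)
    qed
    moreover have "\<Union>D' - \<Union>P \<union> (\<Union>P - \<Union>D') \<subseteq> \<Union>(frontier ` p)"
    proof
      fix x assume "x \<in> \<Union>D' - \<Union>P \<union> (\<Union>P - \<Union>D')"
      then have "x \<in> \<Union>p" "x \<notin> \<Union>P" using sub division_ofD(6)[OF p] by auto
      then obtain K where "K \<in> p" "x \<in> K" "x \<notin> interior K" by (auto simp: P_def)
      then show "x \<in> \<Union>(frontier ` p)" using closure_subset unfolding frontier_def by blast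
    qed
    ultimately show "negligible (\<Union>D' - \<Union>P \<union> (\<Union>P - \<Union>D'))" by (rule negligible_subset)
  qed
  moreover have "\<Union>D' \<subseteq> S" using D'(1) \<D>(4) by blast
  ultimately show thesis using that D'(3) by auto
qed

text \<open>Box families inside \<open>A\<close> and \<open>B\<close> whose volumes fall short by
  less than \<open>e\<close> satisfy the inequality, and their sum lies in \<open>A + B\<close>.
  Continuity of the root lets \<open>e\<close> tend to 0.\<close>

lemma brunn_minkowski_open:
  fixes A B :: "'a::euclidean_space set"
  assumes A: "open A" "bounded A" "A \<noteq> {}" and B: "open B" "bounded B" "B \<noteq> {}"
  shows "root DIM('a) (measure lebesgue A) + root DIM('a) (measure lebesgue B)
    \<le> root DIM('a) (measure lebesgue (A + B))"
proof -
  let ?\<mu> = "measure (lebesgue :: 'a measure)" and ?n = "DIM('a)"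
  define m where "m = min (?\<mu> A) (?\<mu> B)"
  have m: "0 < m" using measure_open_pos[OF A] measure_open_pos[OF B] by (simp add: m_def)
  have approx: "root ?n (?\<mu> A - e) + root ?n (?\<mu> B - e) \<le> root ?n (?\<mu> (A + B))"
    if e: "0 < e" "e < m" for e
  proof -
    obtain P where P: "box_family P" "\<Union>P \<subseteq> A" "?\<mu> A - e < ?\<mu> (\<Union>P)"
      using open_box_family_approximation[OF A(1,2) e(1)] .
    obtain Q where Q: "box_family Q" "\<Union>Q \<subseteq> B" "?\<mu> B - e < ?\<mu> (\<Union>Q)"
      using open_box_family_approximation[OF B(1,2) e(1)] .
    \<comment> \<open>\<open>e < m\<close> makes both approximating volumes positive, so neither
      family can be empty.\<close>
    have ne: "P \<noteq> {}" "Q \<noteq> {}" using P(3) Q(3) e(2) by (auto simp: m_def)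
    have "root ?n (?\<mu> A - e) + root ?n (?\<mu> B - e) \<le> root ?n (?\<mu> (\<Union>P)) + root ?n (?\<mu> (\<Union>Q))"
      using P(3) Q(3) by (intro add_mono real_root_le_mono) auto
    also have "\<dots> \<le> root ?n (?\<mu> (\<Union>P + \<Union>Q))"
      by (rule brunn_minkowski_box_family[OF P(1) Q(1) ne])
    also have "\<dots> \<le> root ?n (?\<mu> (A + B))"
    proof (intro real_root_le_mono measure_mono_fmeasurable set_plus_mono2 P(2) Q(2))
      show "\<Union>P + \<Union>Q \<in> sets lebesgue"
        using P(1) by (intro lmeasurable_open[THEN fmeasurableD] open_set_plus bounded_set_plus)
          (auto intro: open_Union_box_family bounded_Union_box_family P(1) Q(1))
      show "A + B \<in> lmeasurable" using A B by (intro lmeasurable_open open_set_plus bounded_set_plus)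
    qed simp
    finally show ?thesis .
  qed
  show ?thesis
  proof (rule tendsto_upperbound)
    show "((\<lambda>e. root ?n (?\<mu> A - e) + root ?n (?\<mu> B - e)) \<longlongrightarrow> root ?n (?\<mu> A) + root ?n (?\<mu> B)) (at_right 0)"
      by (auto intro!: tendsto_eq_intros)
    show "\<forall>\<^sub>F e in at_right 0. root ?n (?\<mu> A - e) + root ?n (?\<mu> B - e) \<le> root ?n (?\<mu> (A + B))"
      using eventually_at_right_real[OF m] by eventually_elim (use approx in auto)
  qed simp
qed

text \<open>With both interiors nonempty, passing to them changes no volume of \<open>A\<close> or
  \<open>B\<close>. A convex set with empty interior has volume 0, and the sum contains a translate
  of the other set.\<close>

theorem brunn_minkowski_convex:
  fixes A B :: "'a::euclidean_space set"
  assumes A: "convex A" "bounded A" "A \<noteq> {}" and B: "convex B" "bounded B" "B \<noteq> {}"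
  shows "root DIM('a) (measure lebesgue A) + root DIM('a) (measure lebesgue B)
    \<le> root DIM('a) (measure lebesgue (A + B))"
proof -
  let ?\<mu> = "measure (lebesgue :: 'a measure)" and ?n = "DIM('a)"
  have degenerate: "root ?n (?\<mu> C) + root ?n (?\<mu> D) \<le> root ?n (?\<mu> (C + D))"
    if C: "convex C" "bounded C" "C \<noteq> {}" and D: "convex D" "bounded D" and "interior C = {}"
    for C D :: "'a set"
  proof -
    obtain x where "x \<in> C" using C(3) by blast
    have "?\<mu> C = 0"
      using negligible_convex_interior[OF C(1)] \<open>interior C = {}\<close> by (simp add: negligible_imp_measure0)
    moreover have "?\<mu> D \<le> ?\<mu> (C + D)"
    proof -
      have "?\<mu> D = ?\<mu> ((+) x ` D)" by (simp add: measure_translation)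
      also have "\<dots> \<le> ?\<mu> (C + D)"
      proof (rule measure_mono_fmeasurable)
        show "(+) x ` D \<subseteq> C + D" using \<open>x \<in> C\<close> by auto
        show "(+) x ` D \<in> sets lebesgue"
          using D by (intro measurable_convex[THEN fmeasurableD] convex_translation bounded_translation)
        show "C + D \<in> lmeasurable"
          using C D by (intro measurable_convex convex_set_plus bounded_set_plus)
      qed
      finally show ?thesis .
    qed
    ultimately show ?thesis by simp
  qed
  consider "interior A = {}" | "interior B = {}" | "interior A \<noteq> {}" "interior B \<noteq> {}" by blast
  then show ?thesis
  proof cases
    case 1
    then show ?thesis by (intro degenerate A B(1,2))
  next
    case 2
    then show ?thesis using degenerate[OF B A(1,2)] by (simp add: add.commute)
  next
    case 3
    have "root ?n (?\<mu> A) + root ?n (?\<mu> B) = root ?n (?\<mu> (interior A)) + root ?n (?\<mu> (interior B))"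
      using A B by (simp only: measure_interior negligible_convex_frontier)
    also have "\<dots> \<le> root ?n (?\<mu> (interior A + interior B))"
      using 3 A B by (intro brunn_minkowski_open) (auto intro: bounded_interior)
    also have "\<dots> \<le> root ?n (?\<mu> (A + B))"
    proof (intro real_root_le_mono measure_mono_fmeasurable set_plus_mono2 interior_subset)
      show "interior A + interior B \<in> sets lebesgue"
        using A B by (intro lmeasurable_open[THEN fmeasurableD] open_set_plus bounded_set_plus)
          (auto intro: bounded_interior)
      show "A + B \<in> lmeasurable"
        using A B by (intro measurable_convex convex_set_plus bounded_set_plus)
    qed simp
    finally show ?thesis .
  qed
qed

section \<open>Concavity and positivity of the volumes of intersections\<close>

text \<open>\<open>S_comb\<close> makes the slices \<open>S z\<close> a concave family;
  Brunn-Minkowski and the degree-one homogeneity of the root of volume transfer this to their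
  measures.\<close>

lemma root_conv_vol_concave:
  fixes K L :: "(real ^ 'n) set"
  assumes K: "compact K" "convex K" and L: "compact L" "convex L"
    and x: "x \<in> K + L" and y: "y \<in> K + L" and l: "0 \<le> l" "l \<le> 1"
  shows "l * root CARD('n) (conv_vol K L x) + (1 - l) * root CARD('n) (conv_vol K L y)
    \<le> root CARD('n) (conv_vol K L (l *\<^sub>R x + (1 - l) *\<^sub>R y))"
proof -
  define S where "S z = K \<inter> (\<lambda>y. z - y) ` L" for z
  \<comment> \<open>In this form \<open>z\<close> and \<open>u\<close> enter jointly linearly, so
    convex combinations of both pass directly to \<open>K\<close> and \<open>L\<close>.\<close>
  have S_iff: "u \<in> S z \<longleftrightarrow> u \<in> K \<and> z - u \<in> L" for u z
  proof -
    have "u = z - v \<longleftrightarrow> v = z - u" for v by (auto simp: algebra_simps)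
    then show ?thesis by (auto simp: S_def)
  qed
  have S_comb: "s *\<^sub>R u + (1 - s) *\<^sub>R v \<in> S (s *\<^sub>R z + (1 - s) *\<^sub>R w)"
    if "u \<in> S z" "v \<in> S w" "0 \<le> s" "s \<le> 1" for u v z w s
  proof -
    have "s *\<^sub>R (z - u) + (1 - s) *\<^sub>R (w - v) \<in> L"
      using that L(2) by (intro convexD) (auto simp: S_iff)
    moreover have "s *\<^sub>R u + (1 - s) *\<^sub>R v \<in> K"
      using that K(2) by (intro convexD) (auto simp: S_iff)
    ultimately show ?thesis by (simp add: S_iff algebra_simps)
  qed
  \<comment> \<open>Taking both slices at the same \<open>z\<close>, the combined centre collapses
    to \<open>z\<close>.\<close>
  have conv: "convex (S z)" for z
    unfolding convex_alt
    using S_comb[of _ z _ z] by (metis (no_types, lifting) add.commute scaleR_collapse)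
  have bd: "bounded (S z)" for z using K(1) by (auto simp: S_def bounded_Int compact_imp_bounded)
  have ne: "S z \<noteq> {}" if "z \<in> K + L" for z
    using that by (auto elim!: set_plus_elim simp: set_eq_iff S_iff)
  have scale: "root CARD('n) (measure lebesgue ((*\<^sub>R) s ` S z)) = s * root CARD('n) (measure lebesgue (S z))"
    if "0 \<le> s" for s z
    using measure_lebesgue_affine[of s 0 "S z"] that by (simp add: real_root_mult real_root_power_cancel)
  have "l * root CARD('n) (measure lebesgue (S x)) + (1 - l) * root CARD('n) (measure lebesgue (S y))
      = root DIM(real ^ 'n) (measure lebesgue ((*\<^sub>R) l ` S x))
        + root DIM(real ^ 'n) (measure lebesgue ((*\<^sub>R) (1 - l) ` S y))"
    using l by (simp add: scale)
  \<comment> \<open>Degenerate sets do occur here: at \<open>l = 0\<close> or \<open>l = 1\<close>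
    one summand is the singleton of 0, and slices at boundary points of \<open>K + L\<close> may
    have empty interior.\<close>
  also have "\<dots> \<le> root DIM(real ^ 'n) (measure lebesgue ((*\<^sub>R) l ` S x + (*\<^sub>R) (1 - l) ` S y))"
    by (intro brunn_minkowski_convex convex_scaling bounded_scaling conv bd) (use ne x y in auto)
  also have "\<dots> \<le> root DIM(real ^ 'n) (measure lebesgue (S (l *\<^sub>R x + (1 - l) *\<^sub>R y)))"
  proof (intro real_root_le_mono measure_mono_fmeasurable)
    show "(*\<^sub>R) l ` S x + (*\<^sub>R) (1 - l) ` S y \<subseteq> S (l *\<^sub>R x + (1 - l) *\<^sub>R y)"
      using l S_comb by (auto elim!: set_plus_elim)
    show "(*\<^sub>R) l ` S x + (*\<^sub>R) (1 - l) ` S y \<in> sets lebesgue"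
      by (intro measurable_convex[THEN fmeasurableD] convex_set_plus bounded_set_plus
          convex_scaling bounded_scaling conv bd)
    show "S (l *\<^sub>R x + (1 - l) *\<^sub>R y) \<in> lmeasurable" by (intro measurable_convex conv bd)
  qed simp
  finally show ?thesis by (simp add: conv_vol_def S_def)
qed

text \<open>For interior points \<open>a\<close> of \<open>K\<close> and \<open>b\<close> of
  \<open>L\<close>, the slice at \<open>a + b\<close> contains an open neighbourhood of
  \<open>a\<close>. Positivity later shows that \<open>K\<close> meets the reflection of
  \<open>L\<close>, hence that 0 lies in \<open>K + L\<close>.\<close>

lemma max_conv_pos:
  fixes K L :: "(real ^ 'n) set"
  assumes K: "convex_body K" and L: "convex_body L"
  shows "0 < max_conv K L"
proof -
  obtain a b where ab: "a \<in> interior K" "b \<in> interior L"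
    using assms by (auto simp: convex_body_def)
  have K': "compact K" and L': "compact L" using assms by (auto simp: convex_body_def)
  have m: "K \<inter> (\<lambda>y. z - y) ` L \<in> lmeasurable" for z
    using K' L' by (intro lmeasurable_compact compact_Int compact_continuous_image continuous_intros)
  define U where "U = interior K \<inter> (\<lambda>y. (a + b) - y) ` interior L"
  have "open U" unfolding U_def by (intro open_Int open_interior open_neg_translation)
  moreover have "bounded U"
    using K' interior_subset[of K] unfolding U_def by (metis bounded_Int bounded_subset compact_imp_bounded)
  moreover have "a \<in> U" using ab unfolding U_def by (auto intro!: image_eqI[of _ _ b])
  ultimately have "0 < measure lebesgue U" by (intro measure_open_pos) auto
  also have "\<dots> \<le> conv_vol K L (a + b)"
    unfolding conv_vol_def
  proof (rule measure_mono_fmeasurable)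
    show "U \<subseteq> K \<inter> (\<lambda>y. a + b - y) ` L" unfolding U_def using interior_subset by blast
  qed (use \<open>open U\<close> m in auto)
  also have "\<dots> \<le> max_conv K L"
    unfolding max_conv_def
  proof (rule cSUP_upper)
    show "a + b \<in> K + L" using ab interior_subset by blast
    \<comment> \<open>\<open>cSUP_upper\<close> asks for a set bounded above; the volume of
      \<open>K\<close> is such a bound.\<close>
    have "conv_vol K L z \<le> measure lebesgue K" for z
      unfolding conv_vol_def using m[of z] K'
      by (intro measure_mono_fmeasurable) (auto intro: lmeasurable_compact)
    then show "bdd_above (conv_vol K L ` (K + L))" by (auto intro!: bdd_aboveI2)
  qed
  finally show ?thesis .
qed

section \<open>Inclusion of the rescaled theta-sums\<close>

theorem corollary2p5:
  fixes K L :: "(real ^ 'n) set" and \<theta>\<^sub>0 \<theta> :: real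
  assumes "convex_body K" and "convex_body L"
    and "max_conv K L = measure lebesgue (K \<inter> uminus ` L)"
    and "0 \<le> \<theta>\<^sub>0" and "\<theta>\<^sub>0 \<le> \<theta>" and "\<theta> < 1"
  shows "set_divide (theta_sum \<theta>\<^sub>0 K L) (1 - \<theta>\<^sub>0 powr (1 / real CARD('n)))
    \<subseteq> set_divide (theta_sum \<theta> K L) (1 - \<theta> powr (1 / real CARD('n)))"
proof
  let ?n = "CARD('n)"
  define s t where "s = root ?n \<theta>\<^sub>0" and "t = root ?n \<theta>"
  have n: "0 < ?n" by simp
  have st: "s = \<theta>\<^sub>0 powr (1 / real ?n)" "t = \<theta> powr (1 / real ?n)"
    using assms(4,5) by (simp_all only: s_def t_def root_eq_powr_inverse[OF n])
  have le: "0 \<le> s" "s \<le> t" "t < 1"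
    using assms(4-6) by (simp_all add: s_def t_def)
  have KL: "compact K" "convex K" "compact L" "convex L"
    using assms(1,2) by (auto simp: convex_body_def)
  define M where "M = max_conv K L"
  have M: "0 < M" unfolding M_def by (rule max_conv_pos[OF assms(1,2)])
  have vol0: "conv_vol K L 0 = M" by (simp add: M_def assms(3) conv_vol_def)
  \<comment> \<open>The origin must lie in \<open>K + L\<close> to serve as the second point of the
    concavity inequality; a positive maximum attained there forces a common point of
    \<open>K\<close> and the reflected \<open>L\<close>.\<close>
  have zero: "0 \<in> K + L"
  proof -
    have "K \<inter> uminus ` L \<noteq> {}" using M unfolding M_def assms(3) by force
    then obtain u where "- u \<in> K" "u \<in> L" by blast
    then show ?thesis using set_plus_intro[of "- u" K u L] by simp
  qed
  fix z assume "z \<in> set_divide (theta_sum \<theta>\<^sub>0 K L) (1 - \<theta>\<^sub>0 powr (1 / real CARD('n)))"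
  then obtain x where x: "x \<in> K + L" "\<theta>\<^sub>0 * M \<le> conv_vol K L x" and z: "z = x /\<^sub>R (1 - s)"
    by (auto simp: set_divide_def theta_sum_def M_def st)
  define l where "l = (1 - t) / (1 - s)"
  have l: "0 \<le> l" "l \<le> 1" "l * (1 - s) = 1 - t" using le by (auto simp: l_def)
  have "root ?n (\<theta> * M) = root ?n M * t" by (simp add: real_root_mult t_def)
  \<comment> \<open>By \<open>l * (1 - s) = 1 - t\<close>, the number \<open>t\<close> is the convex
    combination of \<open>s\<close> and 1 with weights \<open>l\<close> and \<open>1 - l\<close>,
    matching the points \<open>x\<close> and 0.\<close>
  also have "\<dots> = l * root ?n (\<theta>\<^sub>0 * M) + (1 - l) * root ?n M"
  proof -
    have t: "t = l * s + (1 - l)" using l(3) by (simp add: algebra_simps)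
    show ?thesis unfolding t by (simp add: real_root_mult s_def[symmetric] algebra_simps)
  qed
  also have "\<dots> \<le> l * root ?n (conv_vol K L x) + (1 - l) * root ?n (conv_vol K L 0)"
    using l x(2) by (intro add_mono mult_left_mono real_root_le_mono) (auto simp: vol0)
  also have "\<dots> \<le> root ?n (conv_vol K L (l *\<^sub>R x))"
    using root_conv_vol_concave[OF KL x(1) zero l(1,2)] by simp
  finally have "\<theta> * M \<le> conv_vol K L (l *\<^sub>R x)" by simp
  moreover have "l *\<^sub>R x \<in> K + L"
    using convexD[OF convex_set_plus[OF KL(2,4)] x(1) zero, of l "1 - l"] l by simp
  ultimately have "l *\<^sub>R x \<in> theta_sum \<theta> K L" by (simp add: theta_sum_def M_def)
  \<comment> \<open>Since \<open>1 - t = l * (1 - s)\<close> and \<open>t < 1\<close>, the factor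
    \<open>l\<close> is nonzero and cancels.\<close>
  moreover have "z = (l *\<^sub>R x) /\<^sub>R (1 - t)"
    using le by (simp add: z l_def inverse_eq_divide)
  ultimately show "z \<in> set_divide (theta_sum \<theta> K L) (1 - \<theta> powr (1 / real CARD('n)))"
    unfolding set_divide_def st by (intro image_eqI)
qed

end
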